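(* Let $n\ge1$ and let $\alpha,\beta_1,\dots,\beta_n,\gamma_1,\dots,\gamma_n\in\widehat{\kappa^\times}$. Suppose that $\alpha\neq\varepsilon$ and $\beta_i\neq\gamma_i$ for all $i$. Then, for all $\lambda_1,\dots,\lambda_n\in\kappa^\times$, $$\Big(\prod_{i=1}^n\big(-j(\beta_i,\overline{\beta_i}\gamma_i)\big)\Big)F_A^{(n)}\left({\alpha;\beta_1,\dots,\beta_n\atop\gamma_1,\dots,\gamma_n};\lambda_1,\dots,\lambda_n\right)=\sum_{u_1,\dots,u_n\in\kappa^\times}\overline{\alpha}\Big(1-\sum_{i=1}^n\lambda_iu_i\Big)\prod_{i=1}^n\beta_i(u_i)\,\overline{\beta_i}\gamma_i(1-u_i).$$
   Context: $\kappa$ is a finite field with $q$ elements of characteristic $p$. $\widehat{\kappa^\times}=\mathrm{Hom}(\kappa^\times,\overline{\mathbb{Q}}^\times)$ is the group of multiplicative characters, $\varepsilon$ the trivial character, $\overline{\eta}=\eta^{-1}$; every $\eta\in\widehat{\kappa^\times}$ (including $\varepsilon$) is extended to $\kappa$ by $\eta(0)=0$. A product of characters followed by an argument means the product character evaluated there. $\delta(\eta)=1$ if $\eta=\varepsilon$ and $0$ otherwise. Fix a non-trivial additive character $\psi\in\mathrm{Hom}(\kappa,\overline{\mathbb{Q}}^\times)$. Put $$g(\eta)=-\sum_{x\in\kappa^\times}\psi(x)\eta(x),\quad g^\circ(\eta)=q^{\delta(\eta)}g(\eta),\quad j(\eta_1,\dots,\eta_k)=(-1)^{k-1}\sum_{x_i\in\kappa^\times,\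 x_1+\cdots+x_k=1}\ \prod_{i=1}^k\eta_i(x_i)\ (k\ge 2),$$ $$(\alpha)_\nu=\frac{g(\alpha\nu)}{g(\alpha)},\qquad(\alpha)_\nu^\circ=\frac{g^\circ(\alpha\nu)}{g^\circ(\alpha)}.$$ For $\lambda_i\in\kappa$, $$F_A^{(n)}\left({\alpha;\beta_1,\dots,\beta_n\atop\gamma_1,\dots,\gamma_n};\lambda_1,\dots,\lambda_n\right)=\frac{1}{(1-q)^n}\sum_{\nu_1,\dots,\nu_n\in\widehat{\kappa^\times}}\frac{(\alpha)_{\nu_1\cdots\nu_n}(\beta_1)_{\nu_1}\cdots(\beta_n)_{\nu_n}}{(\gamma_1)^\circ_{\nu_1}\cdots(\gamma_n)^\circ_{\nu_n}(\varepsilon)^\circ_{\nu_1}\cdots(\varepsilon)^\circ_{\nu_n}}\nu_1(\lambda_1)\cdots\nu_n(\lambda_n).$$ *)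

theory Defs
  imports
    Complex_Main
    "HOL-Library.FuncSet"
    "HOL-Library.Cardinality"
    "HOL-Computational_Algebra.Polynomial"
begin

text \<open>The algebraic closure of the rationals is realised inside the complex numbers.\<close>

definition Qbar_units :: "complex set" where
  "Qbar_units = {z. z \<noteq> 0 \<and> algebraic z}"

text \<open>A multiplicative character is represented by its extension by \<open>0\<close> to the whole field,
  so equality of characters is equality of functions.\<close>

definition mult_chars :: "('k::{field,finite} \<Rightarrow> complex) set" where
  "mult_chars = {\<eta>. \<eta> 0 = 0 \<and> (\<forall>x. x \<noteq> 0 \<longrightarrow> \<eta> x \<in> Qbar_units) \<and>
     (\<forall>x y. x \<noteq> 0 \<longrightarrow> y \<noteq> 0 \<longrightarrow> \<eta> (x * y) = \<eta> x * \<eta> y)}"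

definition add_chars :: "('k::{field,finite} \<Rightarrow> complex) set" where
  "add_chars = {\<psi>. (\<forall>x. \<psi> x \<in> Qbar_units) \<and> (\<forall>x y. \<psi> (x + y) = \<psi> x * \<psi> y)}"

definition triv_char :: "'k::{field,finite} \<Rightarrow> complex" where
  "triv_char x = (if x = 0 then 0 else 1)"

definition char_mult ::
    "('k::{field,finite} \<Rightarrow> complex) \<Rightarrow> ('k \<Rightarrow> complex) \<Rightarrow> 'k \<Rightarrow> complex" (infixl "\<odot>" 70) where
  "(\<eta> \<odot> \<nu>) x = \<eta> x * \<nu> x"

text \<open>Since \<open>inverse 0 = 0\<close>, this is again extended by \<open>0\<close>.\<close>

definition char_inv :: "('k::{field,finite} \<Rightarrow> complex) \<Rightarrow> 'k \<Rightarrow> complex" where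
  "char_inv \<eta> x = inverse (\<eta> x)"

text \<open>The case distinction makes the empty product the trivial character.\<close>

definition char_prod :: "'i set \<Rightarrow> ('i \<Rightarrow> 'k::{field,finite} \<Rightarrow> complex) \<Rightarrow> 'k \<Rightarrow> complex" where
  "char_prod I \<nu> x = (if x = 0 then 0 else \<Prod>i\<in>I. \<nu> i x)"

definition char_delta :: "('k::{field,finite} \<Rightarrow> complex) \<Rightarrow> nat" where
  "char_delta \<eta> = (if \<eta> = triv_char then 1 else 0)"

definition gauss_sum ::
    "('k::{field,finite} \<Rightarrow> complex) \<Rightarrow> ('k \<Rightarrow> complex) \<Rightarrow> complex" where
  "gauss_sum \<psi> \<eta> = - (\<Sum>x\<in>UNIV - {0}. \<psi> x * \<eta> x)"

definition gauss_sum_circ ::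
    "('k::{field,finite} \<Rightarrow> complex) \<Rightarrow> ('k \<Rightarrow> complex) \<Rightarrow> complex" where
  "gauss_sum_circ \<psi> \<eta> = of_nat CARD('k) ^ char_delta \<eta> * gauss_sum \<psi> \<eta>"

text \<open>Meant for lists of at least two characters.\<close>

definition jacobi_sum :: "('k::{field,finite} \<Rightarrow> complex) list \<Rightarrow> complex" where
  "jacobi_sum \<eta>s = (-1) ^ (length \<eta>s - 1) *
     (\<Sum>xs | length xs = length \<eta>s \<and> set xs \<subseteq> UNIV - {0} \<and> sum_list xs = 1.
        \<Prod>i<length \<eta>s. (\<eta>s ! i) (xs ! i))"

definition poch ::
    "('k::{field,finite} \<Rightarrow> complex) \<Rightarrow> ('k \<Rightarrow> complex) \<Rightarrow> ('k \<Rightarrow> complex) \<Rightarrow> complex" where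
  "poch \<psi> \<alpha> \<nu> = gauss_sum \<psi> (\<alpha> \<odot> \<nu>) / gauss_sum \<psi> \<alpha>"

definition poch_circ ::
    "('k::{field,finite} \<Rightarrow> complex) \<Rightarrow> ('k \<Rightarrow> complex) \<Rightarrow> ('k \<Rightarrow> complex) \<Rightarrow> complex" where
  "poch_circ \<psi> \<alpha> \<nu> = gauss_sum_circ \<psi> (\<alpha> \<odot> \<nu>) / gauss_sum_circ \<psi> \<alpha>"

text \<open>The families \<open>\<beta>\<close>, \<open>\<gamma>\<close>, \<open>l\<close> are indexed by \<open>{1..n}\<close>; values at other indices are irrelevant.\<close>

definition lauricella_FA ::
    "('k::{field,finite} \<Rightarrow> complex) \<Rightarrow> nat \<Rightarrow> ('k \<Rightarrow> complex) \<Rightarrow> (nat \<Rightarrow> 'k \<Rightarrow> complex) \<Rightarrow>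
     (nat \<Rightarrow> 'k \<Rightarrow> complex) \<Rightarrow> (nat \<Rightarrow> 'k) \<Rightarrow> complex" where
  "lauricella_FA \<psi> n \<alpha> \<beta> \<gamma> l =
     1 / (1 - of_nat CARD('k)) ^ n *
     (\<Sum>\<nu> \<in> {1..n} \<rightarrow>\<^sub>E mult_chars.
        (poch \<psi> \<alpha> (char_prod {1..n} \<nu>) * (\<Prod>i=1..n. poch \<psi> (\<beta> i) (\<nu> i))) /
        ((\<Prod>i=1..n. poch_circ \<psi> (\<gamma> i) (\<nu> i)) * (\<Prod>i=1..n. poch_circ \<psi> triv_char (\<nu> i))) *
        (\<Prod>i=1..n. \<nu> i (l i)))"

end

theory Submission
  imports Defs "HOL-Algebra.Multiplicative_Group"
begin

text \<open>
  The theorem is the finite-field analogue of Lauricella's integral for \<open>F\<^sub>A\<close>, and the proof follows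
  the classical route: a Laplace transform in \<open>\<alpha>\<close> reduces the series in \<open>n\<close> variables to a product of \<open>n\<close>
  confluent series in one variable.

  In a summand of the series only \<open>g(\<alpha>\<nu>\<^sub>1\<dots>\<nu>\<^sub>n)\<close> couples the indices. Written out as a Gauss sum over \<open>t\<close>, it
  becomes a combination of the products \<open>\<nu>\<^sub>1(t)\<dots>\<nu>\<^sub>n(t)\<close>. Exchanging summations therefore turns
  the series into \<open>-g(\<alpha>)\<^sup>-\<^sup>1\<close> times the sum over \<open>t\<close> of \<open>\<psi>(t)\<alpha>(t)\<close> times a product over \<open>i\<close> of one-variable
  series at \<open>\<lambda>\<^sub>it\<close>.

  A one-variable series, multiplied by its Jacobi sum, is the sum over \<open>u\<close> of
  \<open>\<beta>(u)\<delta>(1 - u)\<psi>(-\<lambda>tu)\<close>, where \<open>\<delta>\<close> is \<open>\<gamma>\<close> divided by \<open>\<beta>\<close> (lemma \<open>kummer_integral\<close>). This rests on two facts.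
  First, a Jacobi sum is a quotient of Gauss sums (\<open>gauss_jacobi\<close>), which with the reflection formula
  \<open>gauss_sum_inv\<close> makes each coefficient a Jacobi sum times a Gauss sum; \<open>\<beta> \<noteq> \<gamma>\<close> keeps all these Jacobi
  sums away from the pair of trivial characters. Second, the multiplicative Fourier expansion of
  \<open>\<psi>\<close> has Gauss sums as coefficients (\<open>gauss_sum_inversion\<close>); it follows from the orthogonality of
  characters, hence from the cyclicity of the group of units.

  After this, the additive characters combine to \<open>\<psi>(t(1 - \<Sum>\<lambda>\<^sub>iu\<^sub>i))\<close>, and the sum over \<open>t\<close> is a rescaled
  Gauss sum, namely \<open>-g(\<alpha>)\<close> times the inverse of \<open>\<alpha>\<close> at \<open>1 - \<Sum>\<lambda>\<^sub>iu\<^sub>i\<close> (\<open>gauss_sum_scale\<close>). If that argument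
  is \<open>0\<close>, both vanish because \<open>\<alpha>\<close> is nontrivial.
\<close>

(* The product of characters shares its symbol with scalar multiplication in modules. *)
no_notation Module.smult (infixl "\<odot>\<index>" 70)

section \<open>The multiplicative group of a finite field\<close>

lemma card_field_gt_1: "CARD('k::{field,finite}) > 1"
proof -
  have "card {0, 1 :: 'k} \<le> CARD('k)"
    by (intro card_mono) auto
  then show ?thesis by simp
qed

text \<open>
  Multiplication by \<open>x\<close> permutes the units, so it does not change their product.
\<close>

lemma unit_power_card:
  fixes x :: "'k::{field,finite}"
  assumes "x \<noteq> 0"
  shows "x ^ (CARD('k) - 1) = 1"
proof -
  have "(\<Prod>y\<in>UNIV - {0}. y) = (\<Prod>y\<in>UNIV - {0}. x * y)"
    by (rule prod.reindex_bij_witness[of _ "\<lambda>y. x * y" "\<lambda>y. y / x"]) (use assms in auto)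
  also have "\<dots> = x ^ (CARD('k) - 1) * (\<Prod>y\<in>UNIV - {0}. y)"
    by (simp add: prod.distrib)
  finally show ?thesis by auto
qed

lemma power_mod_eq:
  fixes a :: "'a::monoid_mult"
  assumes "a ^ N = 1"
  shows "a ^ (k mod N) = a ^ k"
proof -
  have "a ^ k = a ^ (N * (k div N) + k mod N)"
    by simp
  also have "\<dots> = a ^ (k mod N)"
    unfolding power_add power_mult assms by simp
  finally show ?thesis ..
qed

text \<open>
  The cyclicity of the group of units is a theorem about the locale of fields, so the type is first
  turned into a ring with carrier \<open>UNIV\<close>. The powers are then cut down to the
  exponents below \<open>CARD('k) - 1\<close>, where they are pairwise distinct for reasons of cardinality; this
  makes the discrete logarithm available as an inverse bijection.
\<close>

lemma mult_group_cyclic: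
  obtains a :: "'k::{field,finite}" where "bij_betw (\<lambda>i. a ^ i) {..<CARD('k) - 1} (UNIV - {0})"
    and "a ^ (CARD('k) - 1) = 1"
proof -
  define R where "R =
    \<lparr>carrier = UNIV :: 'k set, monoid.mult = ((*) :: 'k \<Rightarrow> _), one = 1,
      ring.zero = (0 :: 'k), add = (+)\<rparr>"
  interpret R: field R
  proof -
    have "\<exists>y. x + y = 0" for x :: 'k
      by (rule exI[of _ "- x"]) simp
    moreover have "\<exists>y. x * y = 1" if "x \<noteq> 0" for x :: 'k
      using that by (intro exI[of _ "inverse x"]) simp
    ultimately show "field R"
      unfolding R_def by unfold_locales (auto simp: algebra_simps Units_def)
  qed
  have car: "carrier R = UNIV" and zero: "\<zero>\<^bsub>R\<^esub> = 0"
    by (simp_all add: R_def)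
  obtain a where a: "a \<in> carrier (mult_of R)"
    and gen: "carrier (mult_of R) = {a [^]\<^bsub>R\<^esub> i |i::nat. i \<in> UNIV}"
    using R.finite_field_mult_group_has_gen by (auto simp: car)
  have pow: "x [^]\<^bsub>R\<^esub> (i::nat) = x ^ i" for x :: 'k and i
    by (induction i) (simp_all add: R_def nat_pow_def)
  let ?N = "CARD('k) - 1"
  have units: "carrier (mult_of R) = UNIV - {0 :: 'k}"
    by (simp add: car zero)
  have "a \<noteq> 0"
    using a unfolding units by simp
  have one: "a ^ ?N = 1"
    by (rule unit_power_card) fact
  have "?N > 0"
    using card_field_gt_1[where 'k='k] by simp
  have "(\<lambda>i. a ^ i) ` {..<?N} = UNIV - {0}"
  proof (intro equalityI subsetI)
    fix x :: 'k assume "x \<in> UNIV - {0}"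
    then obtain i where i: "x = a ^ i"
      using gen units by (auto simp: pow)
    have "a ^ i = a ^ (i mod ?N)"
      using power_mod_eq[OF one] by simp
    then show "x \<in> (\<lambda>i. a ^ i) ` {..<?N}"
      using \<open>?N > 0\<close> i by auto
  qed (use \<open>a \<noteq> 0\<close> in auto)
  moreover from this have "inj_on (\<lambda>i. a ^ i) {..<?N}"
    by (intro eq_card_imp_inj_on) (simp_all)
  ultimately show ?thesis
    using that one by (auto simp: bij_betw_def)
qed

section \<open>Multiplicative characters and orthogonality\<close>

text \<open>
  A multiplicative map sends units to roots of unity. The lemma supplies the algebraicity of the
  values when characters are constructed.
\<close>

lemma root_of_unity_Qbar:
  assumes "z ^ n = 1" "n > 0"
  shows "z \<in> Qbar_units"
proof -
  have "algebraic z"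
  proof (rule algebraicI)
    let ?p = "Polynomial.monom 1 n - 1 :: complex poly"
    show "Polynomial.coeff ?p i \<in> \<int>" for i by auto
    show "?p \<noteq> 0"
    proof
      assume "?p = 0"
      then have "Polynomial.coeff ?p n = 0" by simp
      with assms show False by simp
    qed
    show "poly ?p z = 0" using assms by (simp add: Polynomial.poly_monom)
  qed
  moreover have "z \<noteq> 0" using assms by (auto simp: zero_power)
  ultimately show ?thesis by (simp add: Qbar_units_def)
qed

lemma mult_chars_0: "\<eta> \<in> mult_chars \<Longrightarrow> \<eta> 0 = 0"
  by (simp add: mult_chars_def)

lemma mult_chars_mult: "\<eta> \<in> mult_chars \<Longrightarrow> \<eta> (x * y) = \<eta> x * \<eta> y"
  by (cases "x = 0 \<or> y = 0") (auto simp: mult_chars_def)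

lemma mult_chars_nonzero: "\<eta> \<in> mult_chars \<Longrightarrow> x \<noteq> 0 \<Longrightarrow> \<eta> x \<noteq> 0"
  by (auto simp: mult_chars_def Qbar_units_def)

lemma mult_chars_1: "\<eta> \<in> mult_chars \<Longrightarrow> \<eta> 1 = 1"
  using mult_chars_mult[of \<eta> 1 1] mult_chars_nonzero[of \<eta> 1] by simp

lemma mult_chars_power: "\<eta> \<in> mult_chars \<Longrightarrow> \<eta> (x ^ n) = \<eta> x ^ n"
  by (induction n) (simp_all add: mult_chars_1 mult_chars_mult)

lemma mult_chars_power_card:
  fixes \<eta> :: "'k::{field,finite} \<Rightarrow> complex"
  assumes "\<eta> \<in> mult_chars" "x \<noteq> 0"
  shows "\<eta> x ^ (CARD('k) - 1) = 1"
  using mult_chars_power[OF assms(1), of x "CARD('k) - 1"] assms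
  by (simp add: unit_power_card mult_chars_1 del: One_nat_def)

lemma mult_charsI:
  fixes \<eta> :: "'k::{field,finite} \<Rightarrow> complex"
  assumes "\<eta> 0 = 0" "\<eta> 1 = 1" "\<And>x y. x \<noteq> 0 \<Longrightarrow> y \<noteq> 0 \<Longrightarrow> \<eta> (x * y) = \<eta> x * \<eta> y"
  shows "\<eta> \<in> mult_chars"
proof -
  have "\<eta> x \<in> Qbar_units" if "x \<noteq> 0" for x
  proof (rule root_of_unity_Qbar)
    have "\<eta> (x ^ n) = \<eta> x ^ n" for n
      using that by (induction n) (simp_all add: assms)
    from this[of "CARD('k) - 1"] show "\<eta> x ^ (CARD('k) - 1) = 1"
      using that by (simp add: unit_power_card assms del: One_nat_def)
    show "CARD('k) - 1 > 0" using card_field_gt_1[where 'k='k] by simp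
  qed
  then show ?thesis using assms by (simp add: mult_chars_def)
qed

lemma triv_char_in [simp, intro]: "triv_char \<in> mult_chars"
  by (rule mult_charsI) (auto simp: triv_char_def)

lemma char_mult_in [simp, intro]: "\<eta> \<in> mult_chars \<Longrightarrow> \<nu> \<in> mult_chars \<Longrightarrow> \<eta> \<odot> \<nu> \<in> mult_chars"
  by (rule mult_charsI) (auto simp: char_mult_def mult_chars_0 mult_chars_1 mult_chars_mult)

lemma char_inv_in [simp, intro]: "\<eta> \<in> mult_chars \<Longrightarrow> char_inv \<eta> \<in> mult_chars"
  by (rule mult_charsI) (auto simp: char_inv_def mult_chars_0 mult_chars_1 mult_chars_mult)

lemma char_mult_inv_cancel:
  assumes "\<mu> \<in> mult_chars" "\<nu> \<in> mult_chars"
  shows "\<mu> \<odot> (char_inv \<mu> \<odot> \<nu>) = \<nu>"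
proof
  fix z show "(\<mu> \<odot> (char_inv \<mu> \<odot> \<nu>)) z = \<nu> z"
    using mult_chars_nonzero[OF assms(1), of z] mult_chars_0[OF assms(2)]
    by (cases "z = 0") (simp_all add: char_mult_def char_inv_def)
qed

lemma char_inv_mult_cancel:
  assumes "\<mu> \<in> mult_chars" "\<nu> \<in> mult_chars"
  shows "char_inv \<mu> \<odot> (\<mu> \<odot> \<nu>) = \<nu>"
  using char_mult_inv_cancel[OF assms] by (simp add: fun_eq_iff char_mult_def mult_ac)

lemma finite_mult_chars: "finite (mult_chars :: ('k::{field,finite} \<Rightarrow> complex) set)"
proof (rule finite_subset)
  let ?N = "CARD('k) - 1"
  let ?S = "insert 0 {z :: complex. z ^ ?N = 1}"
  show "(mult_chars :: ('k \<Rightarrow> complex) set) \<subseteq> (UNIV \<rightarrow>\<^sub>E ?S)"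
  proof
    fix \<eta> :: "'k \<Rightarrow> complex" assume "\<eta> \<in> mult_chars"
    then have "\<eta> x \<in> ?S" for x
      using mult_chars_power_card[of \<eta> x] mult_chars_0[of \<eta>] by (cases "x = 0") auto
    then show "\<eta> \<in> UNIV \<rightarrow>\<^sub>E ?S" by auto
  qed
  have "?N \<ge> 1" using card_field_gt_1[where 'k='k] by simp
  then show "finite ((UNIV :: 'k set) \<rightarrow>\<^sub>E ?S)"
    by (intro finite_PiE finite.insertI finite_roots_unity) simp_all
qed

text \<open>
  If \<open>\<eta> a \<noteq> 1\<close>, the substitution of \<open>a * x\<close> for \<open>x\<close> multiplies the sum by \<open>\<eta> a\<close>, so that it vanishes.
\<close>

lemma sum_mult_char:
  fixes \<eta> :: "'k::{field,finite} \<Rightarrow> complex"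
  assumes "\<eta> \<in> mult_chars"
  shows "(\<Sum>x\<in>UNIV. \<eta> x) = (if \<eta> = triv_char then of_nat CARD('k) - 1 else 0)"
proof (cases "\<eta> = triv_char")
  case True
  have "(\<Sum>x\<in>UNIV. triv_char (x::'k)) = (\<Sum>x\<in>UNIV - {0::'k}. 1)"
    by (rule sum.mono_neutral_cong_right) (auto simp: triv_char_def)
  also have "\<dots> = of_nat CARD('k) - 1"
    using card_field_gt_1[where 'k='k] by (simp add: of_nat_diff)
  finally show ?thesis using True by simp
next
  case False
  then obtain a where "\<eta> a \<noteq> triv_char a" by blast
  with assms have a: "a \<noteq> 0" "\<eta> a \<noteq> 1"
    by (auto simp: triv_char_def mult_chars_0 split: if_splits)
  have "(\<Sum>x\<in>UNIV. \<eta> x) = (\<Sum>x\<in>UNIV. \<eta> (a * x))"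
    by (rule sum.reindex_bij_witness[of _ "\<lambda>x. a * x" "\<lambda>x. x / a"]) (use a in auto)
  also have "\<dots> = \<eta> a * (\<Sum>x\<in>UNIV. \<eta> x)"
    by (simp add: mult_chars_mult[OF assms] sum_distrib_left)
  finally show ?thesis using a False by auto
qed

text \<open>
  The existence of enough characters, which the second orthogonality relation rests on. The
  character sends a generator to a primitive root of unity of the same order; it is
  \<open>x \<mapsto> \<omega> ^ lg x\<close> with \<open>lg\<close> the discrete logarithm, and it is even injective on the units.
\<close>

lemma mult_chars_separate:
  fixes y :: "'k::{field,finite}"
  assumes "y \<noteq> 0" "y \<noteq> 1"
  obtains \<nu> where "\<nu> \<in> mult_chars" "\<nu> y \<noteq> 1"
proof -
  let ?N = "CARD('k) - 1"
  obtain a :: 'k where bij: "bij_betw (\<lambda>i. a ^ i) {..<?N} (UNIV - {0})" and aN: "a ^ ?N = 1"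
    by (rule mult_group_cyclic)
  have N: "?N > 0" using card_field_gt_1[where 'k='k] by simp
  define \<omega> where "\<omega> = cis (2 * pi / real ?N)"
  have \<omega>_pow: "\<omega> ^ k = cis (2 * pi * real k / real ?N)" for k
    by (simp add: \<omega>_def DeMoivre mult_ac)
  have \<omega>N: "\<omega> ^ ?N = 1" using N unfolding \<omega>_pow by simp
  define lg where "lg = inv_into {..<?N} (\<lambda>i. a ^ i)"
  have lg: "lg x < ?N" "a ^ lg x = x" if "x \<noteq> 0" for x
    using bij_betw_inv_into_right[OF bij, of x] bij_betwE[OF bij_betw_inv_into[OF bij]] that
    by (auto simp: lg_def)
  have lg_pow: "lg (a ^ k) = k mod ?N" for k
  proof -
    have "a ^ k = a ^ (k mod ?N)"
      using power_mod_eq[OF aN] by simp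
    then show ?thesis
      using bij_betw_inv_into_left[OF bij, of "k mod ?N"] N by (simp add: lg_def)
  qed
  have \<omega>_mod: "\<omega> ^ (k mod ?N) = \<omega> ^ k" for k
    by (rule power_mod_eq[OF \<omega>N])
  define \<nu> where "\<nu> x = (if x = 0 then 0 else \<omega> ^ lg x)" for x
  have "\<nu> \<in> mult_chars"
  proof (rule mult_charsI)
    show "\<nu> 0 = 0" "\<nu> 1 = 1"
      using lg_pow[of 0] by (simp_all add: \<nu>_def)
    fix x y :: 'k assume xy: "x \<noteq> 0" "y \<noteq> 0"
    have "lg (x * y) = (lg x + lg y) mod ?N"
      using lg_pow[of "lg x + lg y"] lg xy by (simp add: power_add)
    then show "\<nu> (x * y) = \<nu> x * \<nu> y"
      using xy by (simp add: \<nu>_def \<omega>_mod power_add del: One_nat_def)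
  qed
  moreover have "\<nu> y \<noteq> 1"
  proof
    assume "\<nu> y = 1"
    then have "\<omega> ^ lg y = \<omega> ^ 0" using assms by (simp add: \<nu>_def)
    moreover have "inj_on (\<lambda>k. \<omega> ^ k) {..<?N}"
      unfolding \<omega>_pow using bij_betw_roots_unity[of ?N] N by (auto simp: bij_betw_def)
    ultimately have "lg y = 0"
      using lg(1)[OF assms(1)] N inj_onD[of "\<lambda>k. \<omega> ^ k" "{..<?N}" "lg y" 0]
      by (simp del: One_nat_def)
    then show False using lg(2)[OF assms(1)] assms(2) by simp
  qed
  ultimately show ?thesis by (rule that)
qed

text \<open>
  For \<open>y \<noteq> 1\<close>, translating the summation variable by a character that is not \<open>1\<close> at \<open>y\<close> shows that
  the sum vanishes. At \<open>y = 1\<close> it is the number of characters, which is found by evaluating the double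
  sum of \<open>\<nu> x\<close> over all \<open>\<nu>\<close> and \<open>x\<close> in both orders.
\<close>

lemma sum_over_mult_chars:
  fixes y :: "'k::{field,finite}"
  shows "(\<Sum>\<nu>\<in>mult_chars. \<nu> y) = (if y = 1 then of_nat CARD('k) - 1 else (0::complex))"
proof -
  let ?G = "mult_chars :: ('k \<Rightarrow> complex) set"
  have off: "(\<Sum>\<nu>\<in>?G. \<nu> x) = 0" if x: "x \<noteq> 1" for x
  proof (cases "x = 0")
    case True then show ?thesis by (simp add: mult_chars_0)
  next
    case False
    then obtain \<mu> where \<mu>: "\<mu> \<in> ?G" "\<mu> x \<noteq> 1"
      using mult_chars_separate x by blast
    have "(\<Sum>\<nu>\<in>?G. \<nu> x) = (\<Sum>\<nu>\<in>?G. (\<mu> \<odot> \<nu>) x)"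
      by (rule sum.reindex_bij_witness[of _ "\<lambda>\<nu>. \<mu> \<odot> \<nu>" "\<lambda>\<nu>. char_inv \<mu> \<odot> \<nu>"])
        (simp_all add: \<mu> char_mult_inv_cancel char_inv_mult_cancel)
    also have "\<dots> = \<mu> x * (\<Sum>\<nu>\<in>?G. \<nu> x)"
      by (simp add: char_mult_def sum_distrib_left)
    finally show ?thesis using \<mu> by auto
  qed
  \<comment> \<open>By the vanishing just proved, only \<open>x = 1\<close> contributes to the double sum.\<close>
  have "(\<Sum>\<nu>\<in>?G. \<nu> 1) = (\<Sum>x\<in>UNIV. \<Sum>\<nu>\<in>?G. \<nu> x)"
    by (subst sum.remove[of _ "1::'k"]) (simp_all add: off)
  also have "\<dots> = (\<Sum>\<nu>\<in>?G. \<Sum>x\<in>UNIV. \<nu> x)"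
    by (rule sum.swap)
  also have "\<dots> = (\<Sum>\<nu>\<in>?G. if \<nu> = triv_char then of_nat CARD('k) - 1 else 0)"
    by (intro sum.cong refl sum_mult_char)
  also have "\<dots> = of_nat CARD('k) - 1"
    by (simp add: finite_mult_chars)
  finally show ?thesis using off by auto
qed

section \<open>Additive characters and Gauss sums\<close>

lemma add_char_0: "\<psi> \<in> add_chars \<Longrightarrow> \<psi> 0 = 1"
proof -
  assume "\<psi> \<in> add_chars"
  then have "\<psi> 0 \<noteq> 0" "\<psi> (0 + 0) = \<psi> 0 * \<psi> 0"
    unfolding add_chars_def Qbar_units_def by blast+
  then show "\<psi> 0 = 1" by simp
qed

lemma add_char_add: "\<psi> \<in> add_chars \<Longrightarrow> \<psi> (x + y) = \<psi> x * \<psi> y"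
  by (simp add: add_chars_def)

lemma add_char_sum: "\<psi> \<in> add_chars \<Longrightarrow> \<psi> (\<Sum>i\<in>I. f i) = (\<Prod>i\<in>I. \<psi> (f i))"
  by (induction I rule: infinite_finite_induct) (simp_all add: add_char_0 add_char_add)

lemma sum_add_char:
  fixes \<psi> :: "'k::{field,finite} \<Rightarrow> complex"
  assumes "\<psi> \<in> add_chars" "\<psi> \<noteq> (\<lambda>_. 1)"
  shows "(\<Sum>x\<in>UNIV. \<psi> x) = 0"
proof -
  obtain a where a: "\<psi> a \<noteq> 1" using assms(2) by blast
  have "(\<Sum>x\<in>UNIV. \<psi> x) = (\<Sum>x\<in>UNIV. \<psi> (a + x))"
    by (rule sum.reindex_bij_witness[of _ "\<lambda>x. a + x" "\<lambda>x. x - a"]) auto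
  also have "\<dots> = \<psi> a * (\<Sum>x\<in>UNIV. \<psi> x)"
    by (simp add: add_char_add[OF assms(1)] sum_distrib_left)
  finally show ?thesis using a by auto
qed

lemma triv_char_mult:
  assumes "\<eta> \<in> mult_chars"
  shows "triv_char \<odot> \<eta> = \<eta>" "\<eta> \<odot> triv_char = \<eta>"
  using mult_chars_0[OF assms] by (auto simp: char_mult_def triv_char_def)

lemma sum_split_zero:
  fixes f :: "'k::{zero,finite} \<Rightarrow> 'b::comm_monoid_add"
  shows "(\<Sum>x\<in>UNIV. f x) = f 0 + (\<Sum>x\<in>UNIV - {0}. f x)"
  by (rule sum.remove) simp_all

lemma gauss_sum_UNIV:
  assumes "\<eta> \<in> mult_chars"
  shows "gauss_sum \<psi> \<eta> = - (\<Sum>x\<in>UNIV. \<psi> x * \<eta> x)"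
  unfolding gauss_sum_def
  by (simp add: sum_split_zero mult_chars_0[OF assms])

lemma gauss_sum_triv:
  assumes "\<psi> \<in> add_chars" "\<psi> \<noteq> (\<lambda>_. 1)"
  shows "gauss_sum \<psi> triv_char = 1"
proof -
  have "gauss_sum \<psi> triv_char = - (\<Sum>x\<in>UNIV - {0}. \<psi> x)"
    unfolding gauss_sum_def by (simp add: triv_char_def)
  then show ?thesis
    using sum_add_char[OF assms] by (simp add: sum_split_zero add_char_0[OF assms(1)] add_eq_0_iff)
qed

section \<open>Jacobi sums as convolutions\<close>

text \<open>
  The Jacobi sum of two characters is, up to sign, the value at \<open>1\<close> of their additive convolution.
  Considering the convolution at all points, \<open>0\<close> included, is what relates it to a product of
  Gauss sums.
\<close>

definition char_conv :: "('k::{field,finite} \<Rightarrow> complex) \<Rightarrow> ('k \<Rightarrow> complex) \<Rightarrow> 'k \<Rightarrow> complex" where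
  "char_conv a b s = (\<Sum>x\<in>UNIV. a x * b (s - x))"

text \<open>
  A list in the index set of \<open>jacobi_sum\<close> is determined by its head \<open>x\<close>, which is neither \<open>0\<close>
  nor \<open>1\<close>; at these two points the convolution has zero summands.
\<close>

lemma jacobi_sum_two:
  fixes a b :: "'k::{field,finite} \<Rightarrow> complex"
  assumes "a \<in> mult_chars" "b \<in> mult_chars"
  shows "jacobi_sum [a, b] = - char_conv a b 1"
proof -
  let ?X = "{xs. length xs = length [a, b] \<and> set xs \<subseteq> UNIV - {0} \<and> sum_list xs = 1}"
  have "(\<Sum>xs\<in>?X. \<Prod>i<length [a, b]. ([a, b] ! i) (xs ! i)) =
    (\<Sum>x\<in>UNIV - {0, 1}. a x * b (1 - x))"
  proof (rule sum.reindex_bij_witness[of _ "\<lambda>x. [x, 1 - x]" hd])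
    fix xs :: "'k list" assume "xs \<in> ?X"
    then obtain x y where xs: "xs = [x, y]" "x \<noteq> 0" "y \<noteq> 0" "x + y = 1"
      by (auto simp: length_Suc_conv)
    then have y: "y = 1 - x" by (simp add: eq_diff_eq add.commute)
    show "[hd xs, 1 - hd xs] = xs" "hd xs \<in> UNIV - {0, 1}"
      using xs y by auto
    show "a (hd xs) * b (1 - hd xs) = (\<Prod>i<length [a, b]. ([a, b] ! i) (xs ! i))"
      using xs(1) y by (simp add: lessThan_Suc mult.commute)
  qed auto
  also have "\<dots> = char_conv a b 1"
    unfolding char_conv_def
    by (rule sum.mono_neutral_left) (auto simp: mult_chars_0 assms)
  finally show ?thesis by (simp add: jacobi_sum_def)
qed

text \<open>
  The convolution is homogeneous, as the substitution of \<open>s * x\<close> for \<open>x\<close> shows. At \<open>s = 0\<close> the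
  convolution is a multiple of the sum of \<open>a \<odot> b\<close> instead, which need not vanish.
\<close>

lemma char_conv_scale:
  assumes "a \<in> mult_chars" "b \<in> mult_chars" "s \<noteq> 0"
  shows "char_conv a b s = (a \<odot> b) s * char_conv a b 1"
proof -
  have "char_conv a b s = (\<Sum>x\<in>UNIV. a (s * x) * b (s - s * x))"
    unfolding char_conv_def
    by (rule sum.reindex_bij_witness[of _ "\<lambda>x. s * x" "\<lambda>x. x / s"]) (use assms in auto)
  also have "\<dots> = (\<Sum>x\<in>UNIV. (a \<odot> b) s * (a x * b (1 - x)))"
  proof (rule sum.cong[OF refl])
    fix x
    have "b (s - s * x) = b s * b (1 - x)"
      using mult_chars_mult[OF assms(2), of s "1 - x"] by (simp add: algebra_simps)
    then show "a (s * x) * b (s - s * x) = (a \<odot> b) s * (a x * b (1 - x))"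
      by (simp add: mult_chars_mult[OF assms(1)] char_mult_def mult_ac)
  qed
  finally show ?thesis by (simp add: char_conv_def sum_distrib_left)
qed

lemma char_conv_0:
  fixes a :: "'k::{field,finite} \<Rightarrow> complex"
  assumes "a \<in> mult_chars" "b \<in> mult_chars"
  shows "char_conv a b 0 = b (-1) * (if a \<odot> b = triv_char then of_nat CARD('k) - 1 else 0)"
proof -
  have "b (0 - x) = b (-1) * b x" for x
    using mult_chars_mult[OF assms(2), of "-1" x] by simp
  then have "char_conv a b 0 = b (-1) * (\<Sum>x\<in>UNIV. (a \<odot> b) x)"
    unfolding char_conv_def char_mult_def sum_distrib_left
    by (intro sum.cong refl) (metis mult.left_commute)
  then show ?thesis using sum_mult_char[of "a \<odot> b"] assms by simp
qed

lemma sum_char_conv: "(\<Sum>s\<in>UNIV. \<psi> s * char_conv a b s) =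
    (\<Sum>x\<in>UNIV. \<Sum>y\<in>UNIV. \<psi> (x + y) * (a x * b y))"
proof -
  have "(\<Sum>s\<in>UNIV. \<psi> s * char_conv a b s) = (\<Sum>x\<in>UNIV. \<Sum>s\<in>UNIV. \<psi> s * (a x * b (s - x)))"
    unfolding char_conv_def sum_distrib_left by (rule sum.swap)
  also have "\<dots> = (\<Sum>x\<in>UNIV. \<Sum>y\<in>UNIV. \<psi> (x + y) * (a x * b y))"
  proof (rule sum.cong[OF refl])
    fix x
    show "(\<Sum>s\<in>UNIV. \<psi> s * (a x * b (s - x))) = (\<Sum>y\<in>UNIV. \<psi> (x + y) * (a x * b y))"
      by (rule sum.reindex_bij_witness[of _ "\<lambda>y. x + y" "\<lambda>s. s - x"]) auto
  qed
  finally show ?thesis .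
qed

text \<open>
  A Gauss sum is minus a Fourier coefficient of a character, and the Fourier transform turns
  convolution into multiplication; the two signs cancel.
\<close>

lemma gauss_sum_mult:
  assumes "\<psi> \<in> add_chars" "a \<in> mult_chars" "b \<in> mult_chars"
  shows "gauss_sum \<psi> a * gauss_sum \<psi> b = (\<Sum>s\<in>UNIV. \<psi> s * char_conv a b s)"
proof -
  have "gauss_sum \<psi> a * gauss_sum \<psi> b =
      (\<Sum>x\<in>UNIV. \<Sum>y\<in>UNIV. (\<psi> x * a x) * (\<psi> y * b y))"
    unfolding gauss_sum_UNIV[OF assms(2)] gauss_sum_UNIV[OF assms(3)] minus_mult_minus
    by (rule sum_product)
  also have "\<dots> = (\<Sum>x\<in>UNIV. \<Sum>y\<in>UNIV. \<psi> (x + y) * (a x * b y))"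
    by (intro sum.cong refl) (simp add: add_char_add[OF assms(1)])
  finally show ?thesis unfolding sum_char_conv .
qed

text \<open>
  If \<open>a \<odot> b\<close> is trivial, the convolution is constant on units by homogeneity, and its total is the product of two
  vanishing character sums. So its value at \<open>1\<close> is determined by the one at \<open>0\<close>.
\<close>

lemma char_conv_1_triv:
  fixes a :: "'k::{field,finite} \<Rightarrow> complex"
  assumes "a \<in> mult_chars" "b \<in> mult_chars" "a \<odot> b = triv_char" "a \<noteq> triv_char"
  shows "char_conv a b 1 = - b (-1)"
proof -
  have q: "(of_nat CARD('k) :: complex) - 1 \<noteq> 0"
    using card_field_gt_1[where 'k='k] by (simp add: of_nat_eq_1_iff)
  have "(\<Sum>s\<in>UNIV. char_conv a b s) = (\<Sum>x\<in>UNIV. a x) * (\<Sum>y\<in>UNIV. b y)"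
    unfolding sum_product using sum_char_conv[of "\<lambda>_. 1" a b] by simp
  also have "\<dots> = 0" using assms by (simp add: sum_mult_char)
  finally have "0 = char_conv a b 0 + (\<Sum>s\<in>UNIV - {0}. char_conv a b s)"
    unfolding sum_split_zero by (rule sym)
  also have "(\<Sum>s\<in>UNIV - {0}. char_conv a b s) = (\<Sum>s\<in>UNIV - {0::'k}. char_conv a b 1)"
  proof (rule sum.cong[OF refl])
    fix s :: 'k assume "s \<in> UNIV - {0}"
    then show "char_conv a b s = char_conv a b 1"
      using char_conv_scale[OF assms(1,2), of s] assms(3) by (simp add: triv_char_def)
  qed
  also have "\<dots> = (of_nat CARD('k) - 1) * char_conv a b 1"
    using card_field_gt_1[where 'k='k] by (simp add: of_nat_diff)
  also have "char_conv a b 0 = (of_nat CARD('k) - 1) * b (-1)"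
    using assms by (simp add: char_conv_0 mult_ac)
  finally have "(of_nat CARD('k) - 1) * (b (-1) + char_conv a b 1) = 0"
    by (simp add: distrib_left)
  with q show ?thesis by (simp add: add_eq_0_iff)
qed

section \<open>Relations between Gauss and Jacobi sums\<close>

text \<open>
  The product of Gauss sums is the Fourier coefficient of the convolution. The contribution of the
  nonzero points is \<open>gauss_sum \<psi> (a \<odot> b)\<close> times the Jacobi sum by homogeneity. The point \<open>0\<close>
  contributes only if \<open>a \<odot> b\<close> is trivial, and its contribution then accounts for the factor \<open>q\<close> that
  distinguishes the circled Gauss sum.
\<close>

lemma gauss_jacobi:
  fixes \<psi> a :: "'k::{field,finite} \<Rightarrow> complex"
  assumes \<psi>: "\<psi> \<in> add_chars" "\<psi> \<noteq> (\<lambda>_. 1)"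
    and ab: "a \<in> mult_chars" "b \<in> mult_chars"
    and nontriv: "a \<noteq> triv_char \<or> b \<noteq> triv_char"
  shows "gauss_sum \<psi> a * gauss_sum \<psi> b = gauss_sum_circ \<psi> (a \<odot> b) * jacobi_sum [a, b]"
proof -
  have "gauss_sum \<psi> a * gauss_sum \<psi> b =
      char_conv a b 0 + (\<Sum>s\<in>UNIV - {0}. \<psi> s * char_conv a b s)"
  proof -
    have "gauss_sum \<psi> a * gauss_sum \<psi> b = (\<Sum>s\<in>UNIV. \<psi> s * char_conv a b s)"
      by (rule gauss_sum_mult[OF \<psi>(1) ab])
    also have "\<dots> = \<psi> 0 * char_conv a b 0 + (\<Sum>s\<in>UNIV - {0}. \<psi> s * char_conv a b s)"
      by (rule sum_split_zero)
    finally show ?thesis unfolding add_char_0[OF \<psi>(1)] mult_1 .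
  qed
  also have "(\<Sum>s\<in>UNIV - {0}. \<psi> s * char_conv a b s) =
      (\<Sum>s\<in>UNIV - {0}. \<psi> s * (a \<odot> b) s) * char_conv a b 1"
    unfolding sum_distrib_right
  proof (rule sum.cong[OF refl])
    fix s :: 'k assume "s \<in> UNIV - {0}"
    then show "\<psi> s * char_conv a b s = \<psi> s * (a \<odot> b) s * char_conv a b 1"
      using char_conv_scale[OF ab, of s] by simp
  qed
  also have "\<dots> = - gauss_sum \<psi> (a \<odot> b) * char_conv a b 1"
    by (simp add: gauss_sum_def)
  finally have *: "gauss_sum \<psi> a * gauss_sum \<psi> b =
      char_conv a b 0 - gauss_sum \<psi> (a \<odot> b) * char_conv a b 1" by simp
  show ?thesis
  proof (cases "a \<odot> b = triv_char")
    case True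
    have "a \<noteq> triv_char"
    proof
      assume "a = triv_char"
      with True have "b = triv_char"
        by (simp add: triv_char_mult[OF ab(2)])
      with nontriv \<open>a = triv_char\<close> show False by blast
    qed
    with True have "char_conv a b 1 = - b (-1)"
      by (intro char_conv_1_triv ab)
    with True * show ?thesis
      by (simp add: gauss_sum_circ_def char_delta_def gauss_sum_triv[OF \<psi>] jacobi_sum_two ab
          char_conv_0 algebra_simps)
  next
    case False
    with * show ?thesis
      by (simp add: gauss_sum_circ_def char_delta_def jacobi_sum_two ab char_conv_0)
  qed
qed

text \<open>
  The circled Gauss sum is normalised such that this reflection formula has no exceptional
  character. In particular no Gauss sum vanishes.
\<close>

lemma gauss_sum_inv:
  fixes \<psi> \<eta> :: "'k::{field,finite} \<Rightarrow> complex"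
  assumes \<psi>: "\<psi> \<in> add_chars" "\<psi> \<noteq> (\<lambda>_. 1)" and \<eta>: "\<eta> \<in> mult_chars"
  shows "gauss_sum_circ \<psi> \<eta> * gauss_sum \<psi> (char_inv \<eta>) = of_nat CARD('k) * \<eta> (-1)"
proof (cases "\<eta> = triv_char")
  case True
  have "char_inv triv_char = (triv_char :: 'k \<Rightarrow> complex)"
    by (auto simp: char_inv_def triv_char_def)
  with True show ?thesis
    by (simp add: gauss_sum_circ_def char_delta_def gauss_sum_triv[OF \<psi>])
      (simp add: triv_char_def)
next
  case False
  have triv: "char_inv \<eta> \<odot> \<eta> = triv_char"
    using mult_chars_nonzero[OF \<eta>] mult_chars_0[OF \<eta>]
    by (auto simp: char_mult_def char_inv_def triv_char_def)
  have "char_inv \<eta> \<noteq> triv_char"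
  proof
    assume "char_inv \<eta> = triv_char"
    with triv have "\<eta> = triv_char"
      by (simp add: triv_char_mult[OF \<eta>])
    with False show False ..
  qed
  then have "jacobi_sum [char_inv \<eta>, \<eta>] = \<eta> (-1)"
    using char_conv_1_triv[OF _ \<eta> triv] \<eta> by (simp add: jacobi_sum_two)
  with gauss_jacobi[OF \<psi> _ \<eta>, of "char_inv \<eta>"] triv False \<eta> show ?thesis
    by (simp add: gauss_sum_circ_def char_delta_def gauss_sum_triv[OF \<psi>] mult_ac)
qed

lemma gauss_sum_nonzero:
  fixes \<psi> \<eta> :: "'k::{field,finite} \<Rightarrow> complex"
  assumes \<psi>: "\<psi> \<in> add_chars" "\<psi> \<noteq> (\<lambda>_. 1)" and \<eta>: "\<eta> \<in> mult_chars"
  shows "gauss_sum \<psi> \<eta> \<noteq> 0" "gauss_sum_circ \<psi> \<eta> \<noteq> 0"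
proof -
  have "gauss_sum_circ \<psi> \<eta> * gauss_sum \<psi> (char_inv \<eta>) \<noteq> 0"
    using gauss_sum_inv[OF assms] mult_chars_nonzero[OF \<eta>, of "-1"] by simp
  then show "gauss_sum_circ \<psi> \<eta> \<noteq> 0" by auto
  then show "gauss_sum \<psi> \<eta> \<noteq> 0" by (auto simp: gauss_sum_circ_def)
qed

text \<open>
  For \<open>c \<noteq> 0\<close> this is the substitution of \<open>t / c\<close> for \<open>t\<close>. At \<open>c = 0\<close> both sides vanish: the left one because \<open>\<alpha>\<close> is
  nontrivial, the right one because characters are extended by \<open>0\<close>.
\<close>

lemma gauss_sum_scale:
  assumes \<alpha>: "\<alpha> \<in> mult_chars" "\<alpha> \<noteq> triv_char"
  shows "(\<Sum>t\<in>UNIV - {0}. \<psi> (c * t) * \<alpha> t) = - gauss_sum \<psi> \<alpha> * char_inv \<alpha> c"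
proof (cases "c = 0")
  case True
  have "(\<Sum>t\<in>UNIV - {0}. \<alpha> t) = 0"
    using sum_mult_char[OF \<alpha>(1)] \<alpha> by (simp add: sum_split_zero mult_chars_0)
  then show ?thesis
    using True \<alpha> by (simp add: char_inv_def mult_chars_0 flip: sum_distrib_left)
next
  case False
  have "(\<Sum>t\<in>UNIV - {0}. \<psi> (c * t) * \<alpha> t) = (\<Sum>s\<in>UNIV - {0}. \<psi> s * \<alpha> (inverse c * s))"
    by (rule sum.reindex_bij_witness[of _ "\<lambda>s. s / c" "\<lambda>t. c * t"]) (use False in \<open>auto simp: field_simps\<close>)
  also have "\<dots> = (\<Sum>s\<in>UNIV - {0}. \<psi> s * (char_inv \<alpha> c * \<alpha> s))"
  proof -
    have "\<alpha> c * \<alpha> (inverse c) = 1"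
      using False mult_chars_mult[OF \<alpha>(1), of c "inverse c"] by (simp add: mult_chars_1[OF \<alpha>(1)])
    then show ?thesis
      by (simp add: char_inv_def mult_chars_mult[OF \<alpha>(1)] inverse_unique)
  qed
  finally show ?thesis
    by (simp add: gauss_sum_def sum_distrib_left mult_ac)
qed

text \<open>
  Fourier inversion on the group of units: Gauss sums are the coefficients of \<open>\<psi>\<close> in the basis of
  multiplicative characters.
\<close>

lemma gauss_sum_inversion:
  fixes \<psi> :: "'k::{field,finite} \<Rightarrow> complex"
  assumes "y \<noteq> 0"
  shows "(\<Sum>\<nu>\<in>mult_chars. gauss_sum \<psi> (char_inv \<nu>) * \<nu> y) = (1 - of_nat CARD('k)) * \<psi> y"
proof -
  have quot: "char_inv \<nu> z * \<nu> y = \<nu> (y / z)" if "\<nu> \<in> mult_chars" "z \<noteq> 0" for \<nu> :: "'k \<Rightarrow> complex" and z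
    using mult_chars_mult[OF that(1), of z "y / z"] mult_chars_nonzero[OF that] that(2)
    by (simp add: char_inv_def field_simps)
  have "(\<Sum>\<nu>\<in>mult_chars. gauss_sum \<psi> (char_inv \<nu>) * \<nu> y) =
      - (\<Sum>\<nu>\<in>mult_chars. \<Sum>z\<in>UNIV - {0}. \<psi> z * \<nu> (y / z))"
    unfolding gauss_sum_def mult_minus_left sum_negf sum_distrib_right mult.assoc
    by (intro arg_cong[where f = uminus] sum.cong refl) (simp add: quot)
  also have "\<dots> = - (\<Sum>z\<in>UNIV - {0}. \<psi> z * (\<Sum>\<nu>\<in>mult_chars. \<nu> (y / z)))"
    unfolding sum_distrib_left by (subst sum.swap) (rule refl)
  also have "(\<Sum>z\<in>UNIV - {0}. \<psi> z * (\<Sum>\<nu>\<in>mult_chars. \<nu> (y / z))) =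
      (\<Sum>z\<in>UNIV - {0}. if z = y then \<psi> y * (of_nat CARD('k) - 1) else 0)"
    by (rule sum.cong) (use assms in \<open>auto simp: sum_over_mult_chars\<close>)
  also have "\<dots> = \<psi> y * (of_nat CARD('k) - 1)"
    using assms by simp
  finally show ?thesis by (simp add: algebra_simps)
qed

section \<open>Integral representations\<close>

text \<open>
  The factor with the trivial character takes the place of the factorial in a hypergeometric series.
  The reflection formula turns its reciprocal into a Gauss sum, which is what makes the series a
  Fourier expansion.
\<close>

lemma poch_circ_triv_inverse:
  fixes \<psi> \<nu> :: "'k::{field,finite} \<Rightarrow> complex"
  assumes \<psi>: "\<psi> \<in> add_chars" "\<psi> \<noteq> (\<lambda>_. 1)" and \<nu>: "\<nu> \<in> mult_chars"
  shows "inverse (poch_circ \<psi> triv_char \<nu>) = \<nu> (-1) * gauss_sum \<psi> (char_inv \<nu>)"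
proof -
  have sq: "\<nu> (-1) * \<nu> (-1) = 1"
    using mult_chars_mult[OF \<nu>, of "-1" "-1"] mult_chars_1[OF \<nu>] by simp
  have "gauss_sum_circ \<psi> \<nu> * (\<nu> (-1) * gauss_sum \<psi> (char_inv \<nu>)) =
      of_nat CARD('k) * (\<nu> (-1) * \<nu> (-1))"
    using gauss_sum_inv[OF assms] by (simp add: mult_ac)
  then show ?thesis
    using gauss_sum_nonzero(2)[OF assms]
    by (simp add: poch_circ_def triv_char_mult[OF \<nu>] sq gauss_sum_circ_def[of _ triv_char] char_delta_def
        gauss_sum_triv[OF \<psi>] field_simps)
qed

text \<open>
  Both sides are quotients of Gauss sums by \<open>gauss_jacobi\<close>. The hypothesis \<open>\<beta> \<noteq> \<gamma>\<close> says that the second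
  character \<open>\<delta>\<close> is nontrivial, which makes the factorisation valid for every \<open>\<nu>\<close>.
\<close>

lemma jacobi_poch:
  fixes \<psi> \<beta> \<gamma> \<nu> :: "'k::{field,finite} \<Rightarrow> complex"
  assumes \<psi>: "\<psi> \<in> add_chars" "\<psi> \<noteq> (\<lambda>_. 1)"
    and chars: "\<beta> \<in> mult_chars" "\<gamma> \<in> mult_chars" "\<nu> \<in> mult_chars"
    and ne: "\<beta> \<noteq> \<gamma>"
  defines "\<delta> \<equiv> char_inv \<beta> \<odot> \<gamma>"
  shows "jacobi_sum [\<beta>, \<delta>] * (poch \<psi> \<beta> \<nu> / poch_circ \<psi> \<gamma> \<nu>) = jacobi_sum [\<beta> \<odot> \<nu>, \<delta>]"
proof -
  have \<delta>: "\<delta> \<in> mult_chars" using chars by (simp add: \<delta>_def)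
  have \<beta>\<delta>: "\<beta> \<odot> \<delta> = \<gamma>" unfolding \<delta>_def using chars by (simp add: char_mult_inv_cancel)
  have \<beta>\<nu>\<delta>: "\<beta> \<odot> \<nu> \<odot> \<delta> = \<gamma> \<odot> \<nu>"
    unfolding \<beta>\<delta>[symmetric] by (simp add: fun_eq_iff char_mult_def)
  have "\<delta> \<noteq> triv_char"
  proof
    assume "\<delta> = triv_char"
    with \<beta>\<delta> have "\<beta> = \<gamma>"
      by (simp add: triv_char_mult[OF chars(1)])
    with ne show False ..
  qed
  then have j1: "gauss_sum \<psi> \<beta> * gauss_sum \<psi> \<delta> = gauss_sum_circ \<psi> \<gamma> * jacobi_sum [\<beta>, \<delta>]"
    and j2: "gauss_sum \<psi> (\<beta> \<odot> \<nu>) * gauss_sum \<psi> \<delta> =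
      gauss_sum_circ \<psi> (\<gamma> \<odot> \<nu>) * jacobi_sum [\<beta> \<odot> \<nu>, \<delta>]"
    using gauss_jacobi[OF \<psi> chars(1) \<delta>] gauss_jacobi[OF \<psi> _ \<delta>, of "\<beta> \<odot> \<nu>"] chars
    by (simp_all add: \<beta>\<delta> \<beta>\<nu>\<delta>)
  have nz: "gauss_sum \<psi> \<beta> \<noteq> 0" "gauss_sum_circ \<psi> \<gamma> \<noteq> 0" "gauss_sum_circ \<psi> (\<gamma> \<odot> \<nu>) \<noteq> 0"
    using chars by (simp_all add: gauss_sum_nonzero[OF \<psi>])
  have J: "jacobi_sum [\<beta>, \<delta>] = gauss_sum \<psi> \<beta> * gauss_sum \<psi> \<delta> / gauss_sum_circ \<psi> \<gamma>"
    "jacobi_sum [\<beta> \<odot> \<nu>, \<delta>] =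
      gauss_sum \<psi> (\<beta> \<odot> \<nu>) * gauss_sum \<psi> \<delta> / gauss_sum_circ \<psi> (\<gamma> \<odot> \<nu>)"
    using nz by (simp_all add: j1 j2)
  show ?thesis
    unfolding J poch_def poch_circ_def using nz by (simp add: field_simps)
qed

text \<open>
  The finite analogue of Euler's integral for Kummer's confluent hypergeometric function. Each
  summand is, up to sign, a Jacobi sum \<open>j(\<beta>\<nu>, \<delta>)\<close> times the Gauss sum of the inverse of \<open>\<nu>\<close> times
  \<open>\<nu>(-x)\<close>. Once the Jacobi sum is written out as a sum over \<open>u\<close>, the sum over \<open>\<nu>\<close> is the Fourier expansion of \<open>\<psi> (- (x * u))\<close>.
\<close>

lemma kummer_integral:
  fixes \<psi> \<beta> \<gamma> :: "'k::{field,finite} \<Rightarrow> complex"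
  assumes \<psi>: "\<psi> \<in> add_chars" "\<psi> \<noteq> (\<lambda>_. 1)"
    and chars: "\<beta> \<in> mult_chars" "\<gamma> \<in> mult_chars" and ne: "\<beta> \<noteq> \<gamma>" and x: "x \<noteq> 0"
  defines "\<delta> \<equiv> char_inv \<beta> \<odot> \<gamma>"
  shows "- jacobi_sum [\<beta>, \<delta>] / (1 - of_nat CARD('k)) *
      (\<Sum>\<nu>\<in>mult_chars. poch \<psi> \<beta> \<nu> / (poch_circ \<psi> \<gamma> \<nu> * poch_circ \<psi> triv_char \<nu>) * \<nu> x) =
    (\<Sum>u\<in>UNIV - {0}. \<beta> u * \<delta> (1 - u) * \<psi> (- (x * u)))"
    (is "_ / ?Q * _ = _")
proof -
  have Q: "?Q \<noteq> 0" using card_field_gt_1[where 'k='k] by (simp add: of_nat_eq_1_iff)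
  have \<delta>: "\<delta> \<in> mult_chars" using chars by (simp add: \<delta>_def)
  have "- jacobi_sum [\<beta>, \<delta>] *
      (poch \<psi> \<beta> \<nu> / (poch_circ \<psi> \<gamma> \<nu> * poch_circ \<psi> triv_char \<nu>) * \<nu> x) =
      (\<Sum>u\<in>UNIV - {0}. \<beta> u * \<delta> (1 - u) * (gauss_sum \<psi> (char_inv \<nu>) * \<nu> (- (x * u))))"
    if \<nu>: "\<nu> \<in> mult_chars" for \<nu>
  proof -
    have val: "\<nu> (- (x * u)) = \<nu> (-1) * \<nu> x * \<nu> u" for u
      using mult_chars_mult[OF \<nu>, of "-1" "x * u"] mult_chars_mult[OF \<nu>, of x u] by simp
    have "- jacobi_sum [\<beta>, \<delta>] *
        (poch \<psi> \<beta> \<nu> / (poch_circ \<psi> \<gamma> \<nu> * poch_circ \<psi> triv_char \<nu>) * \<nu> x) =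
      - (jacobi_sum [\<beta>, \<delta>] * (poch \<psi> \<beta> \<nu> / poch_circ \<psi> \<gamma> \<nu>)) *
        inverse (poch_circ \<psi> triv_char \<nu>) * \<nu> x"
      by (simp add: divide_inverse mult_ac)
    also have "\<dots> = char_conv (\<beta> \<odot> \<nu>) \<delta> 1 * (\<nu> (-1) * gauss_sum \<psi> (char_inv \<nu>)) * \<nu> x"
      unfolding \<delta>_def jacobi_poch[OF \<psi> chars \<nu> ne] poch_circ_triv_inverse[OF \<psi> \<nu>]
      using chars \<nu> by (simp add: jacobi_sum_two)
    also have "char_conv (\<beta> \<odot> \<nu>) \<delta> 1 = (\<Sum>u\<in>UNIV - {0}. \<beta> u * \<nu> u * \<delta> (1 - u))"
      unfolding char_conv_def
      by (rule sum.mono_neutral_cong_right) (auto simp: char_mult_def mult_chars_0[OF chars(1)])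
    also have "\<dots> * (\<nu> (-1) * gauss_sum \<psi> (char_inv \<nu>)) * \<nu> x =
        (\<Sum>u\<in>UNIV - {0}. \<beta> u * \<delta> (1 - u) * (gauss_sum \<psi> (char_inv \<nu>) * \<nu> (- (x * u))))"
      unfolding sum_distrib_right val by (simp add: mult_ac)
    finally show ?thesis .
  qed
  then have "- jacobi_sum [\<beta>, \<delta>] *
      (\<Sum>\<nu>\<in>mult_chars. poch \<psi> \<beta> \<nu> / (poch_circ \<psi> \<gamma> \<nu> * poch_circ \<psi> triv_char \<nu>) * \<nu> x) =
    (\<Sum>\<nu>\<in>mult_chars. \<Sum>u\<in>UNIV - {0}.
      \<beta> u * \<delta> (1 - u) * (gauss_sum \<psi> (char_inv \<nu>) * \<nu> (- (x * u))))"
    unfolding sum_distrib_left by (intro sum.cong refl)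
  also have "\<dots> = (\<Sum>u\<in>UNIV - {0}. \<beta> u * \<delta> (1 - u) *
      (\<Sum>\<nu>\<in>mult_chars. gauss_sum \<psi> (char_inv \<nu>) * \<nu> (- (x * u))))"
    unfolding sum_distrib_left by (rule sum.swap)
  also have "\<dots> = (\<Sum>u\<in>UNIV - {0}. ?Q * (\<beta> u * \<delta> (1 - u) * \<psi> (- (x * u))))"
    by (rule sum.cong) (use x in \<open>simp_all add: gauss_sum_inversion mult_ac\<close>)
  also have "\<dots> = ?Q * (\<Sum>u\<in>UNIV - {0}. \<beta> u * \<delta> (1 - u) * \<psi> (- (x * u)))"
    by (simp only: sum_distrib_left)
  finally show ?thesis using Q by (simp add: field_simps)
qed

theorem theorem3p3:
  fixes \<psi> \<alpha> :: "'k::{field,finite} \<Rightarrow> complex"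
    and \<beta> \<gamma> :: "nat \<Rightarrow> 'k \<Rightarrow> complex"
    and l :: "nat \<Rightarrow> 'k"
    and n :: nat
  assumes "\<psi> \<in> add_chars" and "\<psi> \<noteq> (\<lambda>_. 1)"
    and "n \<ge> 1"
    and "\<alpha> \<in> mult_chars"
    and "\<And>i. i \<in> {1..n} \<Longrightarrow> \<beta> i \<in> mult_chars"
    and "\<And>i. i \<in> {1..n} \<Longrightarrow> \<gamma> i \<in> mult_chars"
    and "\<alpha> \<noteq> triv_char"
    and "\<And>i. i \<in> {1..n} \<Longrightarrow> \<beta> i \<noteq> \<gamma> i"
    and "\<And>i. i \<in> {1..n} \<Longrightarrow> l i \<noteq> 0"
  shows "(\<Prod>i=1..n. - jacobi_sum [\<beta> i, char_inv (\<beta> i) \<odot> \<gamma> i]) * lauricella_FA \<psi> n \<alpha> \<beta> \<gamma> l =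
    (\<Sum>u \<in> {1..n} \<rightarrow>\<^sub>E (UNIV - {0}).
       char_inv \<alpha> (1 - (\<Sum>i=1..n. l i * u i)) *
       (\<Prod>i=1..n. \<beta> i (u i) * (char_inv (\<beta> i) \<odot> \<gamma> i) (1 - u i)))"
proof -
  let ?I = "{1..n}" and ?U = "UNIV - {0 :: 'k}" and ?q = "of_nat CARD('k) :: complex"
  define g where "g = gauss_sum \<psi> \<alpha>"
  define c where "c i = - jacobi_sum [\<beta> i, char_inv (\<beta> i) \<odot> \<gamma> i]" for i
  define w where "w i \<nu> = poch \<psi> (\<beta> i) \<nu> / (poch_circ \<psi> (\<gamma> i) \<nu> * poch_circ \<psi> triv_char \<nu>)" for i \<nu>
  define h where "h i u = \<beta> i u * (char_inv (\<beta> i) \<odot> \<gamma> i) (1 - u)" for i u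
  have g: "g \<noteq> 0" unfolding g_def by (rule gauss_sum_nonzero) fact+
  have kummer: "c i / (1 - ?q) * (\<Sum>\<nu>\<in>mult_chars. w i \<nu> * \<nu> (t * l i)) =
      (\<Sum>u\<in>?U. h i u * \<psi> (- (t * l i * u)))" if "i \<in> ?I" "t \<noteq> 0" for i t
    unfolding c_def w_def h_def by (rule kummer_integral) (use that assms in auto)
  \<comment> \<open>Writing out the Gauss sum of \<open>\<alpha>\<nu>\<^sub>1\<dots>\<nu>\<^sub>n\<close> rescales each argument by \<open>t\<close> and decouples the indices.\<close>
  have term_eq: "poch \<psi> \<alpha> (char_prod ?I \<nu>) * (\<Prod>i\<in>?I. w i (\<nu> i) * \<nu> i (l i)) =
      - (\<Sum>t\<in>?U. \<psi> t * \<alpha> t * (\<Prod>i\<in>?I. w i (\<nu> i) * \<nu> i (t * l i))) / g"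
    if \<nu>: "\<nu> \<in> ?I \<rightarrow>\<^sub>E mult_chars" for \<nu>
  proof -
    have "\<nu> i (t * l i) = \<nu> i t * \<nu> i (l i)" if "i \<in> ?I" for i t
      using \<nu> that by (intro mult_chars_mult) auto
    then have "(\<Prod>i\<in>?I. w i (\<nu> i) * \<nu> i (t * l i)) =
        (\<Prod>i\<in>?I. \<nu> i t) * (\<Prod>i\<in>?I. w i (\<nu> i) * \<nu> i (l i))" for t
      unfolding prod.distrib[symmetric] by (intro prod.cong refl) simp
    then have "(\<Sum>t\<in>?U. \<psi> t * \<alpha> t * (\<Prod>i\<in>?I. w i (\<nu> i) * \<nu> i (t * l i))) =
        (\<Sum>t\<in>?U. \<psi> t * (\<alpha> \<odot> char_prod ?I \<nu>) t) * (\<Prod>i\<in>?I. w i (\<nu> i) * \<nu> i (l i))"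
      unfolding sum_distrib_right
      by (intro sum.cong refl) (simp add: char_mult_def char_prod_def)
    then show ?thesis
      by (simp add: poch_def gauss_sum_def[of _ "_ \<odot> _"] g_def)
  qed
  have "(\<Prod>i\<in>?I. c i) * lauricella_FA \<psi> n \<alpha> \<beta> \<gamma> l =
      (\<Prod>i\<in>?I. c i / (1 - ?q)) * (\<Sum>\<nu>\<in>?I \<rightarrow>\<^sub>E mult_chars.
        poch \<psi> \<alpha> (char_prod ?I \<nu>) * (\<Prod>i\<in>?I. w i (\<nu> i) * \<nu> i (l i)))"
    unfolding lauricella_FA_def w_def
    by (simp add: prod.distrib prod_dividef mult_ac)
  also have "\<dots> = (\<Prod>i\<in>?I. c i / (1 - ?q)) * (\<Sum>\<nu>\<in>?I \<rightarrow>\<^sub>E mult_chars.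
        - (\<Sum>t\<in>?U. \<psi> t * \<alpha> t * (\<Prod>i\<in>?I. w i (\<nu> i) * \<nu> i (t * l i))) / g)"
    by (simp only: term_eq cong: sum.cong)
  also have "\<dots> = - (\<Prod>i\<in>?I. c i / (1 - ?q)) * (\<Sum>\<nu>\<in>?I \<rightarrow>\<^sub>E mult_chars. \<Sum>t\<in>?U.
        \<psi> t * \<alpha> t * (\<Prod>i\<in>?I. w i (\<nu> i) * \<nu> i (t * l i))) / g"
    by (simp add: sum_negf flip: sum_divide_distrib)
  also have "\<dots> = - (\<Sum>t\<in>?U. \<psi> t * \<alpha> t * ((\<Prod>i\<in>?I. c i / (1 - ?q)) *
        (\<Sum>\<nu>\<in>?I \<rightarrow>\<^sub>E mult_chars. \<Prod>i\<in>?I. w i (\<nu> i) * \<nu> i (t * l i)))) / g"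
    by (subst sum.swap) (simp add: sum_distrib_left sum_negf mult_ac)
  also have "(\<Sum>t\<in>?U. \<psi> t * \<alpha> t * ((\<Prod>i\<in>?I. c i / (1 - ?q)) *
        (\<Sum>\<nu>\<in>?I \<rightarrow>\<^sub>E mult_chars. \<Prod>i\<in>?I. w i (\<nu> i) * \<nu> i (t * l i)))) =
      (\<Sum>t\<in>?U. \<psi> t * \<alpha> t * (\<Sum>u\<in>?I \<rightarrow>\<^sub>E ?U. \<Prod>i\<in>?I. h i (u i) * \<psi> (- (t * l i * u i))))"
  \<comment> \<open>For fixed \<open>t\<close> the sum over families of characters is a product of one-variable sums.\<close>
  proof (rule sum.cong[OF refl])
    fix t assume "t \<in> ?U"
    have "(\<Prod>i\<in>?I. c i / (1 - ?q)) *
        (\<Sum>\<nu>\<in>?I \<rightarrow>\<^sub>E mult_chars. \<Prod>i\<in>?I. w i (\<nu> i) * \<nu> i (t * l i)) =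
        (\<Prod>i\<in>?I. c i / (1 - ?q)) * (\<Prod>i\<in>?I. \<Sum>\<nu>\<in>mult_chars. w i \<nu> * \<nu> (t * l i))"
      by (subst prod_sum_PiE) (simp_all add: finite_mult_chars)
    also have "\<dots> = (\<Prod>i\<in>?I. \<Sum>u\<in>?U. h i u * \<psi> (- (t * l i * u)))"
      unfolding prod.distrib[symmetric] using \<open>t \<in> ?U\<close> by (intro prod.cong refl kummer) auto
    also have "\<dots> = (\<Sum>u\<in>?I \<rightarrow>\<^sub>E ?U. \<Prod>i\<in>?I. h i (u i) * \<psi> (- (t * l i * u i)))"
      by (rule prod_sum_PiE) auto
    finally show "\<psi> t * \<alpha> t * ((\<Prod>i\<in>?I. c i / (1 - ?q)) *
        (\<Sum>\<nu>\<in>?I \<rightarrow>\<^sub>E mult_chars. \<Prod>i\<in>?I. w i (\<nu> i) * \<nu> i (t * l i))) =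
      \<psi> t * \<alpha> t * (\<Sum>u\<in>?I \<rightarrow>\<^sub>E ?U. \<Prod>i\<in>?I. h i (u i) * \<psi> (- (t * l i * u i)))"
      by simp
  qed
  also have "\<dots> = (\<Sum>u\<in>?I \<rightarrow>\<^sub>E ?U. (\<Prod>i\<in>?I. h i (u i)) *
      (\<Sum>t\<in>?U. \<psi> ((1 - (\<Sum>i\<in>?I. l i * u i)) * t) * \<alpha> t))"
  proof -
    have "\<psi> ((1 - (\<Sum>i\<in>?I. l i * u i)) * t) = \<psi> t * (\<Prod>i\<in>?I. \<psi> (- (t * l i * u i)))" for u t
    proof -
      have "(1 - (\<Sum>i\<in>?I. l i * u i)) * t = t + (\<Sum>i\<in>?I. - (t * l i * u i))"
        by (simp add: sum_negf sum_distrib_left algebra_simps)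
      then show ?thesis using assms(1) by (simp only: add_char_add add_char_sum)
    qed
    then show ?thesis
      unfolding sum_distrib_left by (subst sum.swap) (simp add: prod.distrib mult_ac)
  qed
  also have "\<dots> = (\<Sum>u\<in>?I \<rightarrow>\<^sub>E ?U. (\<Prod>i\<in>?I. h i (u i)) *
      (- g * char_inv \<alpha> (1 - (\<Sum>i\<in>?I. l i * u i))))"
    unfolding g_def gauss_sum_scale[OF assms(4,7)] ..
  also have "\<dots> = - g * (\<Sum>u\<in>?I \<rightarrow>\<^sub>E ?U. char_inv \<alpha> (1 - (\<Sum>i\<in>?I. l i * u i)) * (\<Prod>i\<in>?I. h i (u i)))"
    by (simp add: sum_distrib_left mult_ac sum_negf)
  finally show ?thesis using g by (simp add: c_def h_def)
qed

end
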